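(* Let $\{F_t\}_{t\ge0}$ be a nice Feller process on $\mathbb{R}^d$, $d\ge1$, with symbol $q(x,\xi)$ and Pruitt indices $\beta$ and $\delta$. (i) If $d=1$ and $\beta>1$, then $$\int_{\{|\xi|<r\}}\frac{d\xi}{\sup_{x\in\mathbb{R}}|q(x,\xi)|}=\infty\quad\text{for some } r>0.$$ (ii) If $$\int_{\{|\xi|<r\}}\frac{d\xi}{\inf_{x\in\mathbb{R}^d}\operatorname{Re}q(x,\xi)}<\infty\quad\text{for some } r>0,$$ then $\delta\le d$.
   Context: The Pruitt indices of a process with symbol $q$ are $$\beta:=\sup\Big\{\alpha\ge0:\lim_{|\xi|\to0}\frac{\sup_{x\in\mathbb{R}^d}|q(x,\xi)|}{|\xi|^\alpha}=0\Big\},\qquad \delta:=\sup\Big\{\alpha\ge0:\lim_{|\xi|\to0}\frac{\inf_{x\in\mathbb{R}^d}\operatorname{Re}q(x,\xi)}{|\xi|^\alpha}=0\Big\}.$$ A Feller process $\{F_t\}_{t\ge0}$ on $\mathbb{R}^d$ is a Markov process with state space $(\mathbb{R}^d,\mathcal{B}(\mathbb{R}^d))$, with laws $\mathbb{P}^x$ and expectations $\mathbb{E}^x$ (starting point $x\in\mathbb{R}^d$), whose semigroup $P_tf(x)=\mathbb{E}^x[f(F_t)]$ maps $C_\infty(\mathbb{R}^d)$ (continuous functions vanishing at infinity, with the supremum norm) into itself and is strongly continuous there; it is strong Markov with càdlàg paths. Let $(\mathcal{A},\mathcal{D}_{\mathcal{A}})$ be its (Feller) generator. Condition (C1): $C_c^\infty(\mathbb{R}^d)\subseteq\mathcal{D}_{\mathcal{A}}$.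 Under (C1), for $f\in C_c^\infty(\mathbb{R}^d)$, $\mathcal{A}f(x)=-\int_{\mathbb{R}^d}q(x,\xi)e^{i\langle\xi,x\rangle}\hat f(\xi)\,d\xi$ with $\hat f(\xi)=(2\pi)^{-d}\int e^{-i\langle\xi,x\rangle}f(x)\,dx$, where the function $q:\mathbb{R}^d\times\mathbb{R}^d\to\mathbb{C}$, called the symbol, has for each $x$ the form $$q(x,\xi)=a(x)-i\langle\xi,b(x)\rangle+\tfrac12\langle\xi,c(x)\xi\rangle-\int_{\mathbb{R}^d}\left(e^{i\langle\xi,y\rangle}-1-i\langle\xi,y\rangle1_{\{|y|\le1\}}\right)\nu(x,dy),$$ with $a\ge0$, $b(x)\in\mathbb{R}^d$, $c(x)$ a symmetric nonnegative definite $d\times d$ matrix (all Borel measurable in $x$) and $\nu(x,dy)$ a Borel kernel (the Lévy measure) with $\nu(x,\{0\})=0$, $\int\min\{1,|y|^2\}\nu(x,dy)<\infty$. Condition (C2): there is $C\ge0$ with $\sup_x|q(x,\xi)|\le C(1+|\xi|^2)$ for all $\xi$. Condition (C3): $q(x,0)=a(x)=0$ for all $x$. The process is $\varphi$-irreducible, for a $\sigma$-finite measure $\varphi$ on $\mathcal{B}(\mathbb{R}^d)$, if $\varphi(B)>0$ implies $\int_0^\infty\mathbb{P}^x(F_t\in B)\,dt>0$ for all $x$; then there is a maximal irreducibility measure $\psi$ (i.e. the process is $\bar\varphi$-irreducible iff $\bar\varphi\ll\psi$). Condition (C4): the process is irreducible and its maximal irreducibility measure $\psi$ satisfies $\psi(O)>0$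 for every nonempty open set $O\subseteq\mathbb{R}^d$. A nice Feller process is a Feller process satisfying (C1)-(C4). Convention: $1/0=\infty$ in integrands. *)

theory Defs
  imports "HOL-Probability.Probability"
begin

section \<open>Markov processes with state space \<open>real^'n\<close>\<close>

text \<open>
  A process is given by a measurable space \<open>M\<close> of elementary events (only \<open>space M\<close> and
  \<open>sets M\<close> matter), the laws \<open>P x\<close> on \<open>M\<close>, and the random variables \<open>X t\<close>, of which only those
  with \<open>t \<ge> 0\<close> matter.  Filtrations and stopping times are indexed by \<open>[0, \<infinity>]\<close>.
\<close>

definition natural_filtration ::
    "'w measure \<Rightarrow> (real \<Rightarrow> 'w \<Rightarrow> real^'n) \<Rightarrow> ennreal \<Rightarrow> 'w measure" where
  "natural_filtration M X t =
     sigma (space M) {X s -` B \<inter> space M | s B. 0 \<le> s \<and> ennreal s \<le> t \<and> B \<in> sets borel}"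

lemma filtration_natural_filtration: "filtration (space M) (natural_filtration M X)"
proof
  show "space (natural_filtration M X t) = space M" for t
    unfolding natural_filtration_def by (rule space_measure_of) auto
  fix t u :: ennreal
  assume "t \<le> u"
  then have "{X s -` B \<inter> space M | s B. 0 \<le> s \<and> ennreal s \<le> t \<and> B \<in> sets borel}
      \<subseteq> {X s -` B \<inter> space M | s B. 0 \<le> s \<and> ennreal s \<le> u \<and> B \<in> sets borel}"
    by (blast intro: order_trans)
  then show "sets (natural_filtration M X t) \<subseteq> sets (natural_filtration M X u)"
    unfolding natural_filtration_def
    by (subst (1 2) sets_measure_of) (auto intro!: sigma_sets_mono')
qed

locale markov_process =
  fixes M :: "'w measure" and P :: "real^'n \<Rightarrow> 'w measure" and X :: "real \<Rightarrow> 'w \<Rightarrow> real^'n"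
  assumes prob_space_law: "prob_space (P x)"
    and sets_law: "sets (P x) = sets M"
    and random_variable: "t \<ge> 0 \<Longrightarrow> X t \<in> measurable M borel"
    and start: "AE \<omega> in P x. X 0 \<omega> = x"
    and kernel: "t \<ge> 0 \<Longrightarrow> B \<in> sets borel \<Longrightarrow>
        (\<lambda>x. measure (P x) {\<omega> \<in> space M. X t \<omega> \<in> B}) \<in> borel_measurable borel"
    and markov: "s \<ge> 0 \<Longrightarrow> t \<ge> 0 \<Longrightarrow> B \<in> sets borel \<Longrightarrow>
        AE \<omega> in P x. real_cond_exp (P x) (natural_filtration M X (ennreal s))
            (\<lambda>\<omega>. indicator B (X (s + t) \<omega>)) \<omega>
          = measure (P (X s \<omega>)) {\<omega>' \<in> space M. X t \<omega>' \<in> B}"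

text \<open>On \<open>{\<tau> = \<infinity>}\<close> the random variable inside the conditional expectation below is irrelevant,
  since this event belongs to the sigma-algebra of \<open>\<tau>\<close> and is excluded from the conclusion.\<close>

definition strong_markov ::
    "'w measure \<Rightarrow> (real^'n \<Rightarrow> 'w measure) \<Rightarrow> (real \<Rightarrow> 'w \<Rightarrow> real^'n) \<Rightarrow> bool" where
  "strong_markov M P X \<longleftrightarrow>
     (\<forall>\<tau> :: 'w \<Rightarrow> ennreal. stopping_time (natural_filtration M X) \<tau> \<longrightarrow>
       (\<forall>x. \<forall>t\<ge>0. \<forall>B\<in>sets borel.
          AE \<omega> in P x. \<tau> \<omega> < \<infinity> \<longrightarrow>
            real_cond_exp (P x) (filtration.pre_sigma (space M) (natural_filtration M X) \<tau>)
              (\<lambda>\<omega>. indicator B (X (enn2real (\<tau> \<omega>) + t) \<omega>)) \<omega>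
            = measure (P (X (enn2real (\<tau> \<omega>)) \<omega>)) {\<omega>' \<in> space M. X t \<omega>' \<in> B}))"

definition cadlag :: "(real \<Rightarrow> 'b::topological_space) \<Rightarrow> bool" where
  "cadlag w \<longleftrightarrow> (\<forall>t\<ge>0. (w \<longlongrightarrow> w t) (at_right t)) \<and> (\<forall>t>0. \<exists>l. (w \<longlongrightarrow> l) (at_left t))"


section \<open>Feller processes and their generators\<close>

definition C_infinity :: "(real^'n \<Rightarrow> real) set" where
  "C_infinity = {f. continuous_on UNIV f \<and> (f \<longlongrightarrow> 0) at_infinity}"

definition semigroup_op ::
    "(real^'n \<Rightarrow> 'w measure) \<Rightarrow> (real \<Rightarrow> 'w \<Rightarrow> real^'n) \<Rightarrow> real \<Rightarrow> (real^'n \<Rightarrow> real) \<Rightarrow> real^'n \<Rightarrow> real"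
  where "semigroup_op P X t f x = (\<integral>\<omega>. f (X t \<omega>) \<partial>P x)"

locale feller_process = markov_process M P X
  for M :: "'w measure" and P :: "real^'n \<Rightarrow> 'w measure" and X :: "real \<Rightarrow> 'w \<Rightarrow> real^'n" +
  assumes feller: "t \<ge> 0 \<Longrightarrow> f \<in> C_infinity \<Longrightarrow> semigroup_op P X t f \<in> C_infinity"
    and strongly_continuous: "f \<in> C_infinity \<Longrightarrow>
        uniform_limit UNIV (\<lambda>t. semigroup_op P X t f) f (at_right 0)"
    and cadlag_paths: "\<omega> \<in> space M \<Longrightarrow> cadlag (\<lambda>t. X t \<omega>)"
    and strong_markov: "strong_markov M P X"

definition generator_limit ::
    "(real^'n \<Rightarrow> 'w measure) \<Rightarrow> (real \<Rightarrow> 'w \<Rightarrow> real^'n) \<Rightarrow> (real^'n \<Rightarrow> real) \<Rightarrow> (real^'n \<Rightarrow> real) \<Rightarrow> bool"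
  where "generator_limit P X f g \<longleftrightarrow> f \<in> C_infinity \<and> g \<in> C_infinity \<and>
     uniform_limit UNIV (\<lambda>t x. (semigroup_op P X t f x - f x) / t) g (at_right 0)"

definition generator_domain ::
    "(real^'n \<Rightarrow> 'w measure) \<Rightarrow> (real \<Rightarrow> 'w \<Rightarrow> real^'n) \<Rightarrow> (real^'n \<Rightarrow> real) set" where
  "generator_domain P X = {f. \<exists>g. generator_limit P X f g}"

definition generator ::
    "(real^'n \<Rightarrow> 'w measure) \<Rightarrow> (real \<Rightarrow> 'w \<Rightarrow> real^'n) \<Rightarrow> (real^'n \<Rightarrow> real) \<Rightarrow> real^'n \<Rightarrow> real" where
  "generator P X f = (THE g. generator_limit P X f g)"


section \<open>Test functions, Fourier transform and symbol\<close>

primrec C_k :: "nat \<Rightarrow> (real^'n \<Rightarrow> real) \<Rightarrow> bool" where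
  "C_k 0 f \<longleftrightarrow> continuous_on UNIV f"
| "C_k (Suc k) f \<longleftrightarrow> (\<forall>x. f differentiable (at x)) \<and>
     (\<forall>v. C_k k (\<lambda>x. frechet_derivative f (at x) v))"

definition C_c_infinity :: "(real^'n \<Rightarrow> real) set" where
  "C_c_infinity = {f. (\<forall>k. C_k k f) \<and> compact (closure {x. f x \<noteq> 0})}"

definition fourier :: "(real^'n \<Rightarrow> real) \<Rightarrow> real^'n \<Rightarrow> complex" where
  "fourier f \<xi> = (1 / (2 * pi) ^ CARD('n)) *\<^sub>R (\<integral>x. iexp (- (\<xi> \<bullet> x)) * complex_of_real (f x) \<partial>lborel)"

definition levy_kernel :: "(real^'n \<Rightarrow> (real^'n) measure) \<Rightarrow> bool" where
  "levy_kernel \<nu> \<longleftrightarrow>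
     (\<forall>x. sets (\<nu> x) = sets borel) \<and>
     (\<forall>B\<in>sets borel. (\<lambda>x. emeasure (\<nu> x) B) \<in> borel_measurable borel) \<and>
     (\<forall>x. emeasure (\<nu> x) {0} = 0) \<and>
     (\<forall>x. (\<integral>\<^sup>+y. ennreal (min 1 ((norm y)\<^sup>2)) \<partial>\<nu> x) < \<infinity>)"

definition levy_khintchine ::
    "(real^'n \<Rightarrow> real) \<Rightarrow> (real^'n \<Rightarrow> real^'n) \<Rightarrow> (real^'n \<Rightarrow> real^'n^'n) \<Rightarrow> (real^'n \<Rightarrow> (real^'n) measure) \<Rightarrow>
      real^'n \<Rightarrow> real^'n \<Rightarrow> complex" where
  "levy_khintchine a b c \<nu> x \<xi> =
     complex_of_real (a x) - \<i> * complex_of_real (\<xi> \<bullet> b x)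
       + complex_of_real (1 / 2 * (\<xi> \<bullet> (c x *v \<xi>)))
       - (\<integral>y. (iexp (\<xi> \<bullet> y) - 1 - \<i> * complex_of_real ((\<xi> \<bullet> y) * indicator {y. norm y \<le> 1} y)) \<partial>\<nu> x)"

definition has_levy_khintchine_form :: "(real^'n \<Rightarrow> real^'n \<Rightarrow> complex) \<Rightarrow> bool" where
  "has_levy_khintchine_form q \<longleftrightarrow> (\<exists>a b c \<nu>.
     a \<in> borel_measurable borel \<and> (\<forall>x. 0 \<le> a x) \<and>
     b \<in> borel_measurable borel \<and>
     c \<in> borel_measurable borel \<and> (\<forall>x. transpose (c x) = c x) \<and> (\<forall>x \<xi>. 0 \<le> \<xi> \<bullet> (c x *v \<xi>)) \<and>
     levy_kernel \<nu> \<and>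
     q = levy_khintchine a b c \<nu>)"

definition is_symbol ::
    "(real^'n \<Rightarrow> 'w measure) \<Rightarrow> (real \<Rightarrow> 'w \<Rightarrow> real^'n) \<Rightarrow> (real^'n \<Rightarrow> real^'n \<Rightarrow> complex) \<Rightarrow> bool" where
  "is_symbol P X q \<longleftrightarrow> has_levy_khintchine_form q \<and>
     (\<forall>f\<in>C_c_infinity. \<forall>x.
        complex_of_real (generator P X f x) = - (\<integral>\<xi>. q x \<xi> * iexp (\<xi> \<bullet> x) * fourier f \<xi> \<partial>lborel))"


section \<open>Irreducibility\<close>

definition irreducible_wrt ::
    "'w measure \<Rightarrow> (real^'n \<Rightarrow> 'w measure) \<Rightarrow> (real \<Rightarrow> 'w \<Rightarrow> real^'n) \<Rightarrow> (real^'n) measure \<Rightarrow> bool" where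
  "irreducible_wrt M P X \<phi> \<longleftrightarrow> (\<forall>B\<in>sets borel. emeasure \<phi> B > 0 \<longrightarrow>
     (\<forall>x. (\<integral>\<^sup>+t\<in>{0..}. emeasure (P x) {\<omega> \<in> space M. X t \<omega> \<in> B} \<partial>lborel) > 0))"

definition sigma_finite_borel :: "(real^'n) measure \<Rightarrow> bool" where
  "sigma_finite_borel \<phi> \<longleftrightarrow> sets \<phi> = sets borel \<and> sigma_finite_measure \<phi>"

definition irreducible_process ::
    "'w measure \<Rightarrow> (real^'n \<Rightarrow> 'w measure) \<Rightarrow> (real \<Rightarrow> 'w \<Rightarrow> real^'n) \<Rightarrow> bool" where
  "irreducible_process M P X \<longleftrightarrow> (\<exists>\<phi>. sigma_finite_borel \<phi> \<and> irreducible_wrt M P X \<phi>)"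

text \<open>\<open>absolutely_continuous \<psi> \<phi>\<close> is \<open>\<phi> \<lless> \<psi>\<close>: null sets of the first argument are null for the second.\<close>

definition maximal_irreducibility_measure ::
    "'w measure \<Rightarrow> (real^'n \<Rightarrow> 'w measure) \<Rightarrow> (real \<Rightarrow> 'w \<Rightarrow> real^'n) \<Rightarrow> (real^'n) measure \<Rightarrow> bool" where
  "maximal_irreducibility_measure M P X \<psi> \<longleftrightarrow> sigma_finite_borel \<psi> \<and>
     (\<forall>\<phi>. sigma_finite_borel \<phi> \<longrightarrow> (irreducible_wrt M P X \<phi> \<longleftrightarrow> absolutely_continuous \<psi> \<phi>))"


section \<open>Nice Feller processes and Pruitt indices\<close>

text \<open>In \<open>C3\<close>, the value \<open>q x 0\<close> is the killing rate \<open>a x\<close>, because all other terms of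
  \<open>levy_khintchine\<close> vanish at \<open>\<xi> = 0\<close>.\<close>

locale nice_feller_process = feller_process M P X
  for M :: "'w measure" and P :: "real^'n \<Rightarrow> 'w measure" and X :: "real \<Rightarrow> 'w \<Rightarrow> real^'n" +
  fixes q :: "real^'n \<Rightarrow> real^'n \<Rightarrow> complex"
  assumes C1: "C_c_infinity \<subseteq> generator_domain P X"
    and symbol: "is_symbol P X q"
    and C2: "\<exists>C\<ge>0. \<forall>\<xi> x. cmod (q x \<xi>) \<le> C * (1 + (norm \<xi>)\<^sup>2)"
    and C3: "q x 0 = 0"
    and C4: "irreducible_process M P X"
      "\<exists>\<psi>. maximal_irreducibility_measure M P X \<psi> \<and> (\<forall>U. open U \<longrightarrow> U \<noteq> {} \<longrightarrow> emeasure \<psi> U > 0)"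

text \<open>
  The suprema and infima over \<open>x\<close> are taken in the reals; for nice Feller processes the sets are
  bounded by \<open>C2\<close> and by \<open>Re (q x \<xi>) \<ge> 0\<close>.  The outer suprema are taken in \<open>[0, \<infinity>]\<close>, so that the
  supremum of the empty set is \<open>0\<close>.
\<close>

definition sup_norm_symbol :: "(real^'n \<Rightarrow> real^'n \<Rightarrow> complex) \<Rightarrow> real^'n \<Rightarrow> real" where
  "sup_norm_symbol q \<xi> = (SUP x. cmod (q x \<xi>))"

definition inf_Re_symbol :: "(real^'n \<Rightarrow> real^'n \<Rightarrow> complex) \<Rightarrow> real^'n \<Rightarrow> real" where
  "inf_Re_symbol q \<xi> = (INF x. Re (q x \<xi>))"

definition pruitt_\<beta> :: "(real^'n \<Rightarrow> real^'n \<Rightarrow> complex) \<Rightarrow> ennreal" where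
  "pruitt_\<beta> q = Sup (ennreal ` {\<alpha>. 0 \<le> \<alpha> \<and> ((\<lambda>\<xi>. sup_norm_symbol q \<xi> / norm \<xi> powr \<alpha>) \<longlongrightarrow> 0) (at 0)})"

definition pruitt_\<delta> :: "(real^'n \<Rightarrow> real^'n \<Rightarrow> complex) \<Rightarrow> ennreal" where
  "pruitt_\<delta> q = Sup (ennreal ` {\<alpha>. 0 \<le> \<alpha> \<and> ((\<lambda>\<xi>. inf_Re_symbol q \<xi> / norm \<xi> powr \<alpha>) \<longlongrightarrow> 0) (at 0)})"

end

theory Submission
  imports Defs "HOL-Real_Asymp.Real_Asymp"
begin

text \<open>
  If \<open>f x\<close> is smaller than \<open>norm x powr \<alpha>\<close> near the origin, then the integral of \<open>1 / f\<close> over a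
  small ball of radius \<open>t\<close> is at least a constant times \<open>t powr (d - \<alpha>)\<close>, where \<open>d\<close> is the
  dimension.  For \<open>\<alpha> > d\<close> this is unbounded as \<open>t\<close> tends to \<open>0\<close>, although it never exceeds the
  integral over a fixed ball.  A Pruitt index greater than \<open>d\<close> supplies such an \<open>\<alpha>\<close>.
\<close>

lemma nn_integral_inverse_ge_ball:
  fixes f :: "'a::euclidean_space \<Rightarrow> real" and \<alpha> :: real
  assumes t: "0 < t" "t \<le> r" and "0 \<le> \<alpha>"
    and f: "\<And>x. x \<noteq> 0 \<Longrightarrow> norm x < t \<Longrightarrow> f x \<le> norm x powr \<alpha>"
  shows "ennreal (unit_ball_vol DIM('a) * t powr (DIM('a) - \<alpha>))
    \<le> (\<integral>\<^sup>+x\<in>{x. norm x < r}. 1 / ennreal (f x) \<partial>lborel)"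
proof -
  \<comment> \<open>As \<alpha> \<ge> 0, the constant \<open>t powr \<alpha>\<close> dominates
    \<open>f\<close> on the punctured ball. The origin, where \<open>f\<close> is unconstrained, is
    a null set and disappears in the integral.\<close>
  have bound: "ennreal (t powr - \<alpha>) * indicator (ball 0 t) x
      \<le> 1 / ennreal (f x) * indicator {x. norm x < r} x" if "x \<noteq> 0" for x :: 'a
  proof (cases "norm x < t")
    case True
    have "f x \<le> t powr \<alpha>"
      using f[OF that True] powr_mono2[OF \<open>0 \<le> \<alpha>\<close>, of "norm x" t] True by simp
    \<comment> \<open>If \<open>f x \<le> 0\<close>, then \<open>ennreal (f x) = 0\<close> and the
      convention 1/0 = \<infinity> makes the bound trivial.\<close>
    then have "ennreal (t powr - \<alpha>) \<le> 1 / ennreal (f x)"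
      using t by (cases "0 < f x")
        (auto simp: powr_minus divide_ennreal_def inverse_ennreal ennreal_neg
          intro!: ennreal_leI le_imp_inverse_le)
    then show ?thesis
      using True t by simp
  qed simp
  have "ennreal (unit_ball_vol DIM('a) * t powr (DIM('a) - \<alpha>))
      = ennreal (t powr - \<alpha>) * emeasure lborel (ball (0::'a) t)"
    using t by (simp add: emeasure_ball powr_diff powr_minus powr_realpow field_simps
        flip: ennreal_mult)
  also have "\<dots> = (\<integral>\<^sup>+x\<in>ball (0::'a) t. ennreal (t powr - \<alpha>) \<partial>lborel)"
    by (simp add: nn_integral_cmult_indicator)
  also have "\<dots> \<le> (\<integral>\<^sup>+x\<in>{x. norm x < r}. 1 / ennreal (f x) \<partial>lborel)"
    using AE_lborel_singleton[of "0::'a"] by (intro nn_integral_mono_AE) (auto intro: bound)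
  finally show ?thesis .
qed

lemma nn_integral_inverse_eq_top:
  fixes f :: "'a::euclidean_space \<Rightarrow> real" and \<alpha> :: real
  assumes lim: "((\<lambda>x. f x / norm x powr \<alpha>) \<longlongrightarrow> 0) (at 0)"
    and \<alpha>: "DIM('a) < \<alpha>" and "0 < r"
  shows "(\<integral>\<^sup>+x\<in>{x. norm x < r}. 1 / ennreal (f x) \<partial>lborel) = \<infinity>" (is "?I = _")
proof (rule ccontr)
  assume "?I \<noteq> \<infinity>"
  then obtain K where K: "0 \<le> K" "?I = ennreal K"
    by (cases ?I) auto
  have "eventually (\<lambda>x. f x / norm x powr \<alpha> < 1) (at 0)"
    using order_tendstoD(2)[OF lim] by simp
  then obtain s where s: "0 < s" "\<And>x. x \<noteq> 0 \<Longrightarrow> norm x < s \<Longrightarrow> f x / norm x powr \<alpha> < 1"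
    by (auto simp: eventually_at)
  have f: "f x \<le> norm x powr \<alpha>" if "x \<noteq> 0" "norm x < s" for x
    using s(2)[OF that] that by (simp add: divide_less_eq)
  \<comment> \<open>The sign of the constant factor decides between divergence to +\<infinity> and
    to -\<infinity>, so \<open>real_asymp\<close> has to be given it.\<close>
  have "0 < unit_ball_vol DIM('a)"
    by simp
  then have "filterlim (\<lambda>t. unit_ball_vol DIM('a) * t powr (DIM('a) - \<alpha>)) at_top (at_right 0)"
    using \<alpha> by real_asymp
  then have "eventually (\<lambda>t. K < unit_ball_vol DIM('a) * t powr (DIM('a) - \<alpha>)) (at_right 0)"
    by (simp add: filterlim_at_top_dense)
  \<comment> \<open>Below \<open>s\<close> the bound on \<open>f\<close> holds; below
    \<open>r\<close> the small ball lies in the domain of integration.\<close>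
  moreover have "eventually (\<lambda>t. t \<in> {0<..<min r s}) (at_right 0)"
    using \<open>0 < r\<close> \<open>0 < s\<close> by (intro eventually_at_right_real) simp
  ultimately have "eventually (\<lambda>t. K < unit_ball_vol DIM('a) * t powr (DIM('a) - \<alpha>) \<and>
      t \<in> {0<..<min r s}) (at_right 0)"
    by (rule eventually_conj)
  then obtain t where t: "K < unit_ball_vol DIM('a) * t powr (DIM('a) - \<alpha>)" "0 < t" "t < r" "t < s"
    using eventually_happens by fastforce
  have "ennreal (unit_ball_vol DIM('a) * t powr (DIM('a) - \<alpha>)) \<le> ?I"
    using t \<alpha> by (intro nn_integral_inverse_ge_ball f) auto
  then show False
    using t(1) K by simp
qed

text \<open>A supremum strictly above the dimension has a member \<alpha> above it, to which the
  previous lemma applies. The set has the shape shared by \<open>pruitt_\<beta>\<close> and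
  \<open>pruitt_\<delta>\<close>, so both parts of the theorem are instances.\<close>

lemma nn_integral_inverse_eq_top_of_Sup:
  fixes f :: "'a::euclidean_space \<Rightarrow> real"
  assumes "of_nat DIM('a)
      < Sup (ennreal ` {\<alpha>. 0 \<le> \<alpha> \<and> ((\<lambda>x. f x / norm x powr \<alpha>) \<longlongrightarrow> 0) (at 0)})"
    and "0 < r"
  shows "(\<integral>\<^sup>+x\<in>{x. norm x < r}. 1 / ennreal (f x) \<partial>lborel) = \<infinity>"
proof -
  obtain \<alpha> where lim: "((\<lambda>x. f x / norm x powr \<alpha>) \<longlongrightarrow> 0) (at 0)"
    and "of_nat DIM('a) < ennreal \<alpha>"
    using assms(1) by (auto simp: less_Sup_iff)
  then have "DIM('a) < \<alpha>"
    by (simp add: ennreal_of_nat_eq_real_of_nat ennreal_less_iff)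
  with lim show ?thesis
    using \<open>0 < r\<close> by (rule nn_integral_inverse_eq_top)
qed

theorem theorem2p12:
  fixes M :: "'w measure" and P :: "real^'n \<Rightarrow> 'w measure" and X :: "real \<Rightarrow> 'w \<Rightarrow> real^'n"
    and q :: "real^'n \<Rightarrow> real^'n \<Rightarrow> complex"
  assumes "nice_feller_process M P X q"
  shows "(CARD('n) = 1 \<and> pruitt_\<beta> q > 1 \<longrightarrow>
            (\<exists>r>0. (\<integral>\<^sup>+\<xi>\<in>{\<xi>. norm \<xi> < r}. 1 / ennreal (sup_norm_symbol q \<xi>) \<partial>lborel) = \<infinity>)) \<and>
         ((\<exists>r>0. (\<integral>\<^sup>+\<xi>\<in>{\<xi>. norm \<xi> < r}. 1 / ennreal (inf_Re_symbol q \<xi>) \<partial>lborel) < \<infinity>) \<longrightarrow>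
            pruitt_\<delta> q \<le> of_nat CARD('n))"
proof (intro conjI impI)
  assume "CARD('n) = 1 \<and> pruitt_\<beta> q > 1"
  \<comment> \<open>Divergence holds at every radius; 1 is an arbitrary choice.\<close>
  then have "(\<integral>\<^sup>+\<xi>\<in>{\<xi>. norm \<xi> < 1}. 1 / ennreal (sup_norm_symbol q \<xi>) \<partial>lborel) = \<infinity>"
    by (intro nn_integral_inverse_eq_top_of_Sup) (auto simp: pruitt_\<beta>_def)
  then show "\<exists>r>0. (\<integral>\<^sup>+\<xi>\<in>{\<xi>. norm \<xi> < r}. 1 / ennreal (sup_norm_symbol q \<xi>) \<partial>lborel) = \<infinity>"
    using zero_less_one by blast
next
  assume "\<exists>r>0. (\<integral>\<^sup>+\<xi>\<in>{\<xi>. norm \<xi> < r}. 1 / ennreal (inf_Re_symbol q \<xi>) \<partial>lborel) < \<infinity>"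
  then obtain r where r: "0 < r"
    "(\<integral>\<^sup>+\<xi>\<in>{\<xi>. norm \<xi> < r}. 1 / ennreal (inf_Re_symbol q \<xi>) \<partial>lborel) < \<infinity>"
    by blast
  show "pruitt_\<delta> q \<le> of_nat CARD('n)"
  \<comment> \<open>An index above the dimension would force divergence at the very radius
    \<open>r\<close> where the integral is finite.\<close>
  proof (rule ccontr)
    assume "\<not> pruitt_\<delta> q \<le> of_nat CARD('n)"
    then have "(\<integral>\<^sup>+\<xi>\<in>{\<xi>. norm \<xi> < r}. 1 / ennreal (inf_Re_symbol q \<xi>) \<partial>lborel) = \<infinity>"
      using r(1) by (intro nn_integral_inverse_eq_top_of_Sup) (auto simp: pruitt_\<delta>_def not_le)
    with r(2) show False
      by simp
  qed
qed

end
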